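(* Let $X$ be a Tychonoff space and let $\mathscr{P}$ be an ideal of closed sets in $X$ with $|X_\mathscr{P}|\geq 3$. Then $AG(C_\mathscr{P}(X))$ is uniquely complemented if and only if $|X_\mathscr{P}|=3$.
   Context: $C(X)$ is the ring of all real valued continuous functions on the Tychonoff (completely regular Hausdorff) space $X$; $Z(f)=\{x\in X: f(x)=0\}$. An ideal of closed sets in $X$ is a nonempty family $\mathscr{P}$ of closed subsets of $X$ such that $A,B\in\mathscr{P}$ implies $A\cup B\in\mathscr{P}$, and $A\in\mathscr{P}$, $C\subset A$ with $C$ closed in $X$ implies $C\in\mathscr{P}$. $C_\mathscr{P}(X)=\{f\in C(X): cl_X(X\setminus Z(f))\in\mathscr{P}\}$, a commutative ring (possibly without identity). $X_\mathscr{P}$ is the set of all $x\in X$ having an open neighborhood $V$ with $cl_XV\in\mathscr{P}$. For a commutative ring $R$, $Z(R)^*$ is the set of nonzero zero divisors, i.e. nonzero $a\in R$ with $ab=0$ for some nonzero $b\in R$, and $ann(a)=\{r\in R: ra=0\}$. The annihilator graph $AG(R)$ is the simple graph with vertex set $Z(R)^*$ in which distinct $a,b$ are adjacent iff $ann(a)\cup ann(b)\neq ann(ab)$. Two vertices $a,b$ of a graph are orthogonal, $a\perp b$, if they are adjacent and no other vertex is adjacent to both of them. A graph is complemented if for each vertex $a$ there is a vertex $b$ with $a\perp b$; it is uniquely complemented if it is complemented and $a\perp b$, $a\perp c$ imply that $b$ and $c$ are adjacent to the same set of vertices. *)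

theory Defs
  imports "HOL-Analysis.Analysis" "HOL-Algebra.Ideal"
begin

section \<open>The annihilator graph of a commutative ring\<close>

text \<open>
  Only the carrier, the multiplication and the zero of the record are used below, so that the
  definitions make sense for commutative rings without identity; the field \<open>one\<close> is irrelevant.
\<close>

definition annihilator :: "('r, 'm) ring_scheme \<Rightarrow> 'r \<Rightarrow> 'r set" where
  "annihilator R a = {r \<in> carrier R. r \<otimes>\<^bsub>R\<^esub> a = \<zero>\<^bsub>R\<^esub>}"

definition nonzero_zero_divisors :: "('r, 'm) ring_scheme \<Rightarrow> 'r set" where
  "nonzero_zero_divisors R =
     {a \<in> carrier R. a \<noteq> \<zero>\<^bsub>R\<^esub> \<and> (\<exists>b \<in> carrier R. b \<noteq> \<zero>\<^bsub>R\<^esub> \<and> a \<otimes>\<^bsub>R\<^esub> b = \<zero>\<^bsub>R\<^esub>)}"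

text \<open>A simple graph is a pair of a vertex set and a set of edges, each edge being a set of two
  distinct vertices.\<close>

type_synonym 'v simple_graph = "'v set \<times> 'v set set"

abbreviation vertices :: "'v simple_graph \<Rightarrow> 'v set" where
  "vertices G \<equiv> fst G"

abbreviation edges :: "'v simple_graph \<Rightarrow> 'v set set" where
  "edges G \<equiv> snd G"

definition adjacent :: "'v simple_graph \<Rightarrow> 'v \<Rightarrow> 'v \<Rightarrow> bool" where
  "adjacent G a b \<longleftrightarrow> {a, b} \<in> edges G"

definition AG :: "('r, 'm) ring_scheme \<Rightarrow> 'r simple_graph" where
  "AG R = (nonzero_zero_divisors R,
     {{a, b} | a b. a \<in> nonzero_zero_divisors R \<and> b \<in> nonzero_zero_divisors R \<and> a \<noteq> b \<and>
        annihilator R a \<union> annihilator R b \<noteq> annihilator R (a \<otimes>\<^bsub>R\<^esub> b)})"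

definition orthogonal_vertices :: "'v simple_graph \<Rightarrow> 'v \<Rightarrow> 'v \<Rightarrow> bool" where
  "orthogonal_vertices G a b \<longleftrightarrow>
     a \<in> vertices G \<and> b \<in> vertices G \<and> adjacent G a b \<and>
     \<not> (\<exists>c \<in> vertices G. c \<noteq> a \<and> c \<noteq> b \<and> adjacent G a c \<and> adjacent G b c)"

definition complemented_graph :: "'v simple_graph \<Rightarrow> bool" where
  "complemented_graph G \<longleftrightarrow> (\<forall>a \<in> vertices G. \<exists>b \<in> vertices G. orthogonal_vertices G a b)"

definition uniquely_complemented_graph :: "'v simple_graph \<Rightarrow> bool" where
  "uniquely_complemented_graph G \<longleftrightarrow>
     complemented_graph G \<and>
     (\<forall>a \<in> vertices G. \<forall>b \<in> vertices G. \<forall>c \<in> vertices G.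
        orthogonal_vertices G a b \<longrightarrow> orthogonal_vertices G a c \<longrightarrow>
        {v \<in> vertices G. adjacent G b v} = {v \<in> vertices G. adjacent G c v})"


section \<open>The rings \<open>C(X)\<close> and \<open>C\<^sub>\<P>(X)\<close>\<close>

definition Tychonoff_space :: "'a topology \<Rightarrow> bool" where
  "Tychonoff_space X \<longleftrightarrow> completely_regular_space X \<and> Hausdorff_space X"

definition ideal_of_closed_sets :: "'a topology \<Rightarrow> 'a set set \<Rightarrow> bool" where
  "ideal_of_closed_sets X \<P> \<longleftrightarrow>
     \<P> \<noteq> {} \<and> (\<forall>A \<in> \<P>. closedin X A) \<and>
     (\<forall>A \<in> \<P>. \<forall>B \<in> \<P>. A \<union> B \<in> \<P>) \<and>
     (\<forall>A \<in> \<P>. \<forall>C. C \<subseteq> A \<longrightarrow> closedin X C \<longrightarrow> C \<in> \<P>)"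

text \<open>Functions on the space are represented by their extensional representatives, so that
  equality in the carrier is equality on \<open>topspace X\<close>.\<close>

definition C_ring :: "'a topology \<Rightarrow> ('a \<Rightarrow> real) ring" where
  "C_ring X =
     \<lparr>carrier = {f \<in> extensional (topspace X). continuous_map X euclideanreal f},
      monoid.mult = (\<lambda>f g. \<lambda>x \<in> topspace X. f x * g x),
      one = (\<lambda>x \<in> topspace X. 1),
      zero = (\<lambda>x \<in> topspace X. 0),
      add = (\<lambda>f g. \<lambda>x \<in> topspace X. f x + g x)\<rparr>"

definition zero_set :: "'a topology \<Rightarrow> ('a \<Rightarrow> real) \<Rightarrow> 'a set" where
  "zero_set X f = {x \<in> topspace X. f x = 0}"

text \<open>The subring of \<open>C(X)\<close> consisting of the functions with support in \<open>\<P>\<close>. Its \<open>one\<close> field is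
  inherited from \<open>C(X)\<close> and need not lie in the carrier.\<close>

definition CP_ring :: "'a topology \<Rightarrow> 'a set set \<Rightarrow> ('a \<Rightarrow> real) ring" where
  "CP_ring X \<P> =
     (C_ring X)\<lparr>carrier := {f \<in> carrier (C_ring X).
        X closure_of (topspace X - zero_set X f) \<in> \<P>}\<rparr>"

definition P_points :: "'a topology \<Rightarrow> 'a set set \<Rightarrow> 'a set" where
  "P_points X \<P> = {x \<in> topspace X. \<exists>V. openin X V \<and> x \<in> V \<and> X closure_of V \<in> \<P>}"

lemma C_ring_cring: "cring (C_ring X)"
proof (rule cringI)
  show "abelian_group (C_ring X)"
  proof (rule abelian_groupI)
    fix f assume f: "f \<in> carrier (C_ring X)"
    have "(\<lambda>x \<in> topspace X. - f x) \<in> carrier (C_ring X)"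
      using f by (auto simp: C_ring_def intro: continuous_map_eq[OF continuous_map_minus])
    moreover have "(\<lambda>x \<in> topspace X. - f x) \<oplus>\<^bsub>C_ring X\<^esub> f = \<zero>\<^bsub>C_ring X\<^esub>"
      by (auto simp: C_ring_def)
    ultimately show "\<exists>g \<in> carrier (C_ring X). g \<oplus>\<^bsub>C_ring X\<^esub> f = \<zero>\<^bsub>C_ring X\<^esub>"
      by blast
  qed (auto simp: C_ring_def algebra_simps fun_eq_iff extensional_def
        intro: continuous_map_eq[OF continuous_map_add]
          continuous_map_eq[OF continuous_map_const[THEN iffD2]])
  show "comm_monoid (C_ring X)"
    by (rule comm_monoidI)
      (auto simp: C_ring_def algebra_simps fun_eq_iff extensional_def
        intro: continuous_map_eq[OF continuous_map_real_mult]
          continuous_map_eq[OF continuous_map_const[THEN iffD2]])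
qed (auto simp: C_ring_def algebra_simps)

lemma CP_ring_ideal:
  assumes P: "ideal_of_closed_sets X \<P>"
  shows "ideal (carrier (CP_ring X \<P>)) (C_ring X)"
proof -
  interpret C: cring "C_ring X" by (rule C_ring_cring)
  let ?supp = "\<lambda>f. X closure_of (topspace X - zero_set X f)"
  have mono: "?supp f \<in> \<P>" if "A \<in> \<P>" "?supp f \<subseteq> A" for f A
    using P that by (auto simp: ideal_of_closed_sets_def)
  have empty: "{} \<in> \<P>"
    using P by (fastforce simp: ideal_of_closed_sets_def)
  have union: "A \<union> B \<in> \<P>" if "A \<in> \<P>" "B \<in> \<P>" for A B
    using P that by (auto simp: ideal_of_closed_sets_def)
  have supp_zero: "?supp \<zero>\<^bsub>C_ring X\<^esub> = {}"
    by (auto simp: C_ring_def zero_set_def)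
  have supp_add: "?supp (f \<oplus>\<^bsub>C_ring X\<^esub> g) \<subseteq> ?supp f \<union> ?supp g" for f g
    unfolding closure_of_Un[symmetric]
    by (rule closure_of_mono) (auto simp: C_ring_def zero_set_def)
  have supp_mult: "?supp (h \<otimes>\<^bsub>C_ring X\<^esub> f) \<subseteq> ?supp f"
    "?supp (f \<otimes>\<^bsub>C_ring X\<^esub> h) \<subseteq> ?supp f" for f h
    by (rule closure_of_mono, fastforce simp: C_ring_def zero_set_def)+
  have mult: "f \<otimes>\<^bsub>C_ring X\<^esub> h \<in> carrier (CP_ring X \<P>)"
    "h \<otimes>\<^bsub>C_ring X\<^esub> f \<in> carrier (CP_ring X \<P>)"
    if "f \<in> carrier (CP_ring X \<P>)" "h \<in> carrier (C_ring X)" for f h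
    using that mono[OF _ supp_mult(1), of f h] mono[OF _ supp_mult(2), of f h]
    by (auto simp: CP_ring_def)
  show ?thesis
  proof (rule idealI[OF C.ring_axioms])
    show "subgroup (carrier (CP_ring X \<P>)) (add_monoid (C_ring X))"
    proof (rule C.add.subgroupI)
      show "carrier (CP_ring X \<P>) \<noteq> {}"
      proof -
        have "\<zero>\<^bsub>C_ring X\<^esub> \<in> carrier (CP_ring X \<P>)"
          using C.zero_closed supp_zero empty by (simp add: CP_ring_def)
        then show ?thesis by blast
      qed
    next
      fix f assume f: "f \<in> carrier (CP_ring X \<P>)"
      then have fC: "f \<in> carrier (C_ring X)" by (simp add: CP_ring_def)
      have "\<ominus>\<^bsub>C_ring X\<^esub> f = (\<ominus>\<^bsub>C_ring X\<^esub> \<one>\<^bsub>C_ring X\<^esub>) \<otimes>\<^bsub>C_ring X\<^esub> f"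
        using fC by (simp add: C.l_minus)
      then show "\<ominus>\<^bsub>C_ring X\<^esub> f \<in> carrier (CP_ring X \<P>)"
        using mult(2)[OF f] by simp
    next
      fix f g assume fg: "f \<in> carrier (CP_ring X \<P>)" "g \<in> carrier (CP_ring X \<P>)"
      then show "f \<oplus>\<^bsub>C_ring X\<^esub> g \<in> carrier (CP_ring X \<P>)"
        using mono[OF union supp_add, of f g] by (auto simp: CP_ring_def)
    qed (auto simp: CP_ring_def)
  qed (auto intro: mult)
qed

end

theory Submission
  imports Defs
begin

text \<open>
  Everything about the graph can be read off from the cozero sets \<open>coz f = X - Z(f)\<close>, which are
  open subsets of \<open>X\<^sub>\<P>\<close>. Since \<open>r f = 0\<close> says that \<open>coz r\<close> and \<open>coz f\<close> are disjoint, and since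
  complete regularity provides members of \<open>C\<^sub>\<P>(X)\<close> supported near any given point of \<open>X\<^sub>\<P>\<close>, two
  vertices \<open>f\<close> and \<open>g\<close> are adjacent iff neither of \<open>coz f\<close>, \<open>coz g\<close> is contained in the closure
  of the other (\<open>adjacent_iff\<close>): up to closures, adjacency is incomparability of cozero sets.

  Suppose that \<open>X\<^sub>\<P>\<close> has four distinct points. Choose \<open>f\<close> that is nonzero at two of them and whose
  support avoids the other two. Then \<open>f\<close> has no complement. Indeed, let \<open>g\<close> be adjacent to \<open>f\<close>, with
  \<open>q \<in> coz f - cl (coz g)\<close> and \<open>p \<in> coz g - cl (coz f)\<close>. There are a second point \<open>q'\<close> in
  \<open>coz f\<close> and a second point \<open>p'\<close> of \<open>X\<^sub>\<P>\<close> off \<open>cl (coz f)\<close>. A function \<open>h\<close> that is nonzero at \<open>q\<close>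
  and \<open>p'\<close> and whose support avoids \<open>q'\<close> and \<open>p\<close> is adjacent to both: \<open>p'\<close> and \<open>q'\<close> witness
  adjacency to \<open>f\<close>, while \<open>q\<close> and \<open>p\<close> witness adjacency to \<open>g\<close>. So the graph is not even
  complemented (\<open>not_complemented\<close>).

  If \<open>X\<^sub>\<P>\<close> is finite, then it is discrete, its subsets are exactly the cozero sets, and adjacency is
  plain incomparability. Orthogonality then forces complementary cozero sets
  (\<open>orthogonal_imp_cozero_complement\<close>), which gives uniqueness. When there are exactly three
  points, complementary proper sets are orthogonal, because one of the two is a singleton,
  and a set incomparable with \<open>{x}\<close> is contained in the complement of \<open>{x}\<close>.
\<close>

section \<open>Cozero sets in \<open>C\<^sub>\<P>(X)\<close>\<close>

definition coz :: "'a topology \<Rightarrow> ('a \<Rightarrow> real) \<Rightarrow> 'a set" where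
  "coz X f = topspace X - zero_set X f"

lemma in_coz_iff [simp]: "x \<in> coz X f \<longleftrightarrow> x \<in> topspace X \<and> f x \<noteq> 0"
  by (auto simp: coz_def zero_set_def)

lemma coz_subset_closure: "coz X f \<subseteq> X closure_of coz X f"
  by (rule closure_of_subset) auto

lemma openin_coz:
  assumes "continuous_map X euclideanreal f"
  shows "openin X (coz X f)"
proof -
  have "coz X f = {x \<in> topspace X. f x \<in> - {0}}" by auto
  then show ?thesis
    using openin_continuous_map_preimage[OF assms, of "- {0}"] by (simp add: open_Compl)
qed

lemma CP_carrier_iff:
  "f \<in> carrier (CP_ring X \<P>) \<longleftrightarrow>
     f \<in> extensional (topspace X) \<and> continuous_map X euclideanreal f \<and> X closure_of coz X f \<in> \<P>"
  by (auto simp: CP_ring_def C_ring_def coz_def)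

lemma CP_mult: "f \<otimes>\<^bsub>CP_ring X \<P>\<^esub> g = (\<lambda>x \<in> topspace X. f x * g x)"
  and CP_add: "f \<oplus>\<^bsub>CP_ring X \<P>\<^esub> g = (\<lambda>x \<in> topspace X. f x + g x)"
  and CP_zero: "\<zero>\<^bsub>CP_ring X \<P>\<^esub> = (\<lambda>x \<in> topspace X. 0)"
  by (simp_all add: CP_ring_def C_ring_def)

lemma CP_mult_eq_zero_iff:
  "f \<otimes>\<^bsub>CP_ring X \<P>\<^esub> g = \<zero>\<^bsub>CP_ring X \<P>\<^esub> \<longleftrightarrow> coz X f \<inter> coz X g = {}"
proof -
  have "f \<otimes>\<^bsub>CP_ring X \<P>\<^esub> g = \<zero>\<^bsub>CP_ring X \<P>\<^esub> \<longleftrightarrow> (\<forall>x \<in> topspace X. f x * g x = 0)"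
    by (force simp: CP_mult CP_zero fun_eq_iff restrict_def)
  then show ?thesis by auto
qed

lemma coz_mult: "coz X (f \<otimes>\<^bsub>CP_ring X \<P>\<^esub> g) = coz X f \<inter> coz X g"
  by (auto simp: CP_mult)

lemma CP_eq_zero_iff:
  assumes "f \<in> carrier (CP_ring X \<P>)"
  shows "f = \<zero>\<^bsub>CP_ring X \<P>\<^esub> \<longleftrightarrow> coz X f = {}"
proof
  assume "coz X f = {}"
  then have "\<And>x. x \<in> topspace X \<Longrightarrow> f x = 0" by auto
  with assms show "f = \<zero>\<^bsub>CP_ring X \<P>\<^esub>"
    by (auto simp: CP_zero CP_carrier_iff extensional_def fun_eq_iff restrict_def)
qed (auto simp: CP_zero)

lemma mem_vertices_iff:
  "f \<in> vertices (AG (CP_ring X \<P>)) \<longleftrightarrow>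
     f \<in> carrier (CP_ring X \<P>) \<and> coz X f \<noteq> {} \<and>
     (\<exists>g \<in> carrier (CP_ring X \<P>). coz X g \<noteq> {} \<and> coz X f \<inter> coz X g = {})"
  using CP_eq_zero_iff[of _ X \<P>]
  unfolding AG_def fst_conv nonzero_zero_divisors_def mem_Collect_eq CP_mult_eq_zero_iff[of X]
  by blast

lemma coz_subset_P_points:
  assumes "f \<in> carrier (CP_ring X \<P>)"
  shows "coz X f \<subseteq> P_points X \<P>"
proof -
  have "openin X (coz X f)" "X closure_of coz X f \<in> \<P>"
    using assms openin_coz by (auto simp only: CP_carrier_iff)
  then show ?thesis using openin_subset unfolding P_points_def by blast
qed

text \<open>Passing to closures does not change which open sets are met.\<close>

lemma coz_Int_coz_empty_iff:
  assumes "f \<in> carrier (CP_ring X \<P>)"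
  shows "coz X f \<inter> coz X g = {} \<longleftrightarrow> coz X f \<inter> X closure_of coz X g = {}"
  using assms openin_coz[of X f] by (simp add: CP_carrier_iff openin_Int_closure_of_eq_empty)

section \<open>Adjacency as incomparability of cozero sets\<close>

locale Tychonoff_closed_ideal =
  fixes X :: "'a topology" and \<P> :: "'a set set"
  assumes Tychonoff: "Tychonoff_space X"
    and ideal_\<P>: "ideal_of_closed_sets X \<P>"
begin

abbreviation "R \<equiv> CP_ring X \<P>"
abbreviation "Y \<equiv> P_points X \<P>"

lemma Y_subset: "Y \<subseteq> topspace X"
  by (auto simp: P_points_def)

lemma CP_add_closed: "f \<in> carrier R \<Longrightarrow> g \<in> carrier R \<Longrightarrow> f \<oplus>\<^bsub>R\<^esub> g \<in> carrier R"
  using additive_subgroup.a_closed[OF ideal.axioms(1)[OF CP_ring_ideal[OF ideal_\<P>]]]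
  by (simp add: CP_ring_def)

lemma CP_zero_closed: "\<zero>\<^bsub>R\<^esub> \<in> carrier R"
  using additive_subgroup.zero_closed[OF ideal.axioms(1)[OF CP_ring_ideal[OF ideal_\<P>]]]
  by (simp add: CP_ring_def)

lemma closed_finite: "finite F \<Longrightarrow> F \<subseteq> topspace X \<Longrightarrow> closedin X F"
  using Tychonoff Hausdorff_imp_t1_space t1_space_closedin_finite
  unfolding Tychonoff_space_def by blast

lemma bump_at_point:
  assumes x: "x \<in> Y" and U: "openin X U" "x \<in> U"
  obtains f where "f \<in> carrier R" "\<And>y. y \<in> topspace X \<Longrightarrow> 0 \<le> f y" "f x \<noteq> 0"
    "X closure_of coz X f \<subseteq> U"
proof -
  obtain V where V: "openin X V" "x \<in> V" "X closure_of V \<in> \<P>"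
    using x by (auto simp: P_points_def)
  define W where "W = U \<inter> V"
  have W: "openin X W" "x \<in> W" using U V by (auto simp: W_def)
  have "closedin X (topspace X - W)" using W(1) by (simp add: closedin_diff)
  moreover have "x \<in> topspace X - (topspace X - W)" using W openin_subset[of X W] by blast
  ultimately obtain g where g: "continuous_map X (top_of_set {0..1::real}) g" "g x = 0"
      "g ` (topspace X - W) \<subseteq> {1}"
    using Tychonoff unfolding Tychonoff_space_def completely_regular_space_def by blast
  have gc: "continuous_map X euclideanreal g"
    using g(1) by (rule continuous_map_into_fulltopology)
  \<comment> \<open>Cutting off at height 1/2 keeps the closure of the cozero set, and not just the cozero
    set itself, inside \<open>W\<close>.\<close>
  define f where "f = (\<lambda>y \<in> topspace X. max (1/2 - g y) 0)"
  have fc: "continuous_map X euclideanreal f"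
    unfolding f_def
    by (rule continuous_map_eq[where f = "\<lambda>y. max (1/2 - g y) 0"])
      (auto intro!: continuous_map_real_max continuous_map_diff gc)
  have "closedin X {y \<in> topspace X. g y \<in> {..1/2}}"
    by (rule closedin_continuous_map_preimage[OF gc]) simp
  moreover have "coz X f \<subseteq> {y \<in> topspace X. g y \<in> {..1/2}}"
    by (auto simp: f_def)
  ultimately have "X closure_of coz X f \<subseteq> {y \<in> topspace X. g y \<in> {..1/2}}"
    by (rule closure_of_minimal[rotated])
  also have "\<dots> \<subseteq> W"
  proof
    fix y assume y: "y \<in> {y \<in> topspace X. g y \<in> {..1/2}}"
    then have "g y \<noteq> 1" by auto
    then show "y \<in> W" using g(3) y by blast
  qed
  finally have cl: "X closure_of coz X f \<subseteq> W" .
  have "V \<subseteq> X closure_of V" using V(1) by (intro closure_of_subset openin_subset)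
  then have "X closure_of coz X f \<subseteq> X closure_of V" using cl by (auto simp: W_def)
  then have "X closure_of coz X f \<in> \<P>"
    using ideal_\<P> V(3) closedin_closure_of[of X "coz X f"]
    unfolding ideal_of_closed_sets_def by blast
  then have "f \<in> carrier R"
    using fc by (simp add: CP_carrier_iff f_def)
  moreover have "f x \<noteq> 0" using g(2) x Y_subset by (auto simp: f_def)
  ultimately show thesis
    using that[of f] cl by (auto simp: f_def W_def)
qed

text \<open>Adding nonnegative bumps cannot destroy the nonzero values already obtained.\<close>

lemma bump_at_finite_set:
  assumes "finite F" "F \<subseteq> Y" "openin X U" "F \<subseteq> U"
  obtains f where "f \<in> carrier R" "F \<subseteq> coz X f" "X closure_of coz X f \<subseteq> U"
proof -
  have "\<exists>f \<in> carrier R. (\<forall>y \<in> topspace X. 0 \<le> f y) \<and> F \<subseteq> coz X f \<and> X closure_of coz X f \<subseteq> U"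
    using assms(1,2,4)
  proof (induction F)
    case empty
    have "X closure_of coz X \<zero>\<^bsub>R\<^esub> = {}"
      using CP_eq_zero_iff[OF CP_zero_closed] by (simp only: simp_thms closure_of_empty)
    moreover have "\<forall>y \<in> topspace X. 0 \<le> \<zero>\<^bsub>R\<^esub> y" by (simp add: CP_zero)
    ultimately show ?case using CP_zero_closed by blast
  next
    case (insert x F)
    then obtain f where f: "f \<in> carrier R" "\<forall>y \<in> topspace X. 0 \<le> f y" "F \<subseteq> coz X f"
        "X closure_of coz X f \<subseteq> U" by auto
    obtain g where g: "g \<in> carrier R" "\<And>y. y \<in> topspace X \<Longrightarrow> 0 \<le> g y" "g x \<noteq> 0"
        "X closure_of coz X g \<subseteq> U"
      using bump_at_point[of x U] insert.prems assms(3) by auto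
    have coz: "coz X (f \<oplus>\<^bsub>R\<^esub> g) = coz X f \<union> coz X g"
      using f(2) g(2) by (auto simp: CP_add add_nonneg_eq_0_iff)
    show ?case
    proof (intro bexI conjI)
      show "f \<oplus>\<^bsub>R\<^esub> g \<in> carrier R" by (rule CP_add_closed[OF f(1) g(1)])
      show "\<forall>y \<in> topspace X. 0 \<le> (f \<oplus>\<^bsub>R\<^esub> g) y" using f(2) g(2) by (auto simp: CP_add)
      have "x \<in> coz X g" using insert.prems Y_subset g(3) by auto
      then show "insert x F \<subseteq> coz X (f \<oplus>\<^bsub>R\<^esub> g)" using f(3) unfolding coz by blast
      show "X closure_of coz X (f \<oplus>\<^bsub>R\<^esub> g) \<subseteq> U"
        using f(4) g(4) by (simp add: coz)
    qed
  qed
  then show thesis using that by blast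
qed

lemma annihilator_separates:
  assumes "x \<in> Y" "x \<notin> X closure_of coz X f"
  obtains r where "r \<in> carrier R" "x \<in> coz X r" "coz X r \<inter> coz X f = {}"
proof -
  have "openin X (topspace X - X closure_of coz X f)" by auto
  then obtain r where r: "r \<in> carrier R" "{x} \<subseteq> coz X r"
      "X closure_of coz X r \<subseteq> topspace X - X closure_of coz X f"
    using bump_at_finite_set[of "{x}"] assms Y_subset by blast
  have "coz X r \<inter> X closure_of coz X f = {}" using coz_subset_closure[of X r] r(3) by blast
  then show thesis using that r(1,2) by (simp add: coz_Int_coz_empty_iff[OF r(1)])
qed

lemma mem_verticesI:
  assumes "f \<in> carrier R" "coz X f \<noteq> {}" "x \<in> Y" "x \<notin> X closure_of coz X f"
  shows "f \<in> vertices (AG R)"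
proof -
  obtain r where "r \<in> carrier R" "x \<in> coz X r" "coz X r \<inter> coz X f = {}"
    using annihilator_separates assms(3,4) by blast
  then show ?thesis using assms(1,2) unfolding mem_vertices_iff by blast
qed

text \<open>
  An element \<open>r\<close> with \<open>r f g = 0\<close>, \<open>r f \<noteq> 0\<close> and \<open>r g \<noteq> 0\<close> is nonzero at some point of \<open>coz f\<close>,
  and near that point \<open>g\<close> vanishes; the same holds with \<open>f\<close> and \<open>g\<close> exchanged.
  Conversely, \<open>r + s\<close> is such an element whenever \<open>r\<close> kills \<open>g\<close> but not \<open>f\<close>, and \<open>s\<close> kills
  \<open>f\<close> but not \<open>g\<close>.
\<close>

lemma annihilator_Un_neq_iff:
  assumes f: "f \<in> carrier R" and g: "g \<in> carrier R"
  shows "annihilator R f \<union> annihilator R g \<noteq> annihilator R (f \<otimes>\<^bsub>R\<^esub> g) \<longleftrightarrow>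
    \<not> coz X f \<subseteq> X closure_of coz X g \<and> \<not> coz X g \<subseteq> X closure_of coz X f"
    (is "?L \<longleftrightarrow> ?A \<and> ?B")
proof -
  have ann: "annihilator R h = {r \<in> carrier R. coz X r \<inter> coz X h = {}}" for h
    by (simp add: annihilator_def CP_mult_eq_zero_iff)
  have L: "?L \<longleftrightarrow> (\<exists>r \<in> carrier R. coz X r \<inter> coz X f \<inter> coz X g = {} \<and>
      coz X r \<inter> coz X f \<noteq> {} \<and> coz X r \<inter> coz X g \<noteq> {})"
    unfolding ann coz_mult by blast
  have off_closure: "x \<notin> X closure_of coz X k"
    if "r \<in> carrier R" "h \<in> carrier R" "x \<in> coz X r" "x \<in> coz X h"
      "coz X r \<inter> coz X h \<inter> coz X k = {}" for r h k x
  proof -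
    have "openin X (coz X r \<inter> coz X h)"
      using that(1,2) by (intro openin_Int openin_coz) (auto simp: CP_carrier_iff)
    then have "coz X r \<inter> coz X h \<inter> X closure_of coz X k = {}"
      using that(5) openin_Int_closure_of_eq_empty by blast
    then show ?thesis using that(3,4) by blast
  qed
  show ?thesis
  proof
    assume ?L
    then obtain r x y where r: "r \<in> carrier R" "coz X r \<inter> coz X f \<inter> coz X g = {}"
        and x: "x \<in> coz X r" "x \<in> coz X f" and y: "y \<in> coz X r" "y \<in> coz X g"
      unfolding L by blast
    have "x \<notin> X closure_of coz X g" using off_closure[OF r(1) f x r(2)] .
    moreover have "y \<notin> X closure_of coz X f" using off_closure[OF r(1) g y] r(2) by blast
    ultimately show "?A \<and> ?B" using x y by blast
  next
    assume "?A \<and> ?B"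
    then obtain x y where x: "x \<in> coz X f" "x \<notin> X closure_of coz X g"
        and y: "y \<in> coz X g" "y \<notin> X closure_of coz X f" by blast
    have "x \<in> Y" "y \<in> Y" using x y coz_subset_P_points f g by blast+
    then obtain r s where r: "r \<in> carrier R" "x \<in> coz X r" "coz X r \<inter> coz X g = {}"
        and s: "s \<in> carrier R" "y \<in> coz X s" "coz X s \<inter> coz X f = {}"
      using annihilator_separates x(2) y(2) by metis
    have t: "r \<oplus>\<^bsub>R\<^esub> s \<in> carrier R" by (rule CP_add_closed[OF r(1) s(1)])
    have sub: "coz X (r \<oplus>\<^bsub>R\<^esub> s) \<subseteq> coz X r \<union> coz X s" by (auto simp: CP_add)
    have "s x = 0" "r y = 0" using x(1) y(1) r(3) s(3) by fastforce+
    then have xy: "x \<in> coz X (r \<oplus>\<^bsub>R\<^esub> s)" "y \<in> coz X (r \<oplus>\<^bsub>R\<^esub> s)"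
      using r(2) s(2) by (auto simp: CP_add)
    show ?L unfolding L
      using t sub xy x(1) y(1) r(3) s(3) by (intro bexI[of _ "r \<oplus>\<^bsub>R\<^esub> s"]) blast+
  qed
qed

lemma adjacent_iff:
  "adjacent (AG R) f g \<longleftrightarrow> f \<in> vertices (AG R) \<and> g \<in> vertices (AG R) \<and>
     \<not> coz X f \<subseteq> X closure_of coz X g \<and> \<not> coz X g \<subseteq> X closure_of coz X f"
proof -
  have incomparable_imp_neq: "f \<noteq> g" if "\<not> coz X f \<subseteq> X closure_of coz X g"
    using that coz_subset_closure[of X f] by metis
  have "adjacent (AG R) f g \<longleftrightarrow> f \<in> vertices (AG R) \<and> g \<in> vertices (AG R) \<and> f \<noteq> g \<and>
      annihilator R f \<union> annihilator R g \<noteq> annihilator R (f \<otimes>\<^bsub>R\<^esub> g)"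
  proof -
    have "f \<otimes>\<^bsub>R\<^esub> g = g \<otimes>\<^bsub>R\<^esub> f" by (simp add: CP_mult mult.commute)
    then show ?thesis
      unfolding adjacent_def AG_def fst_conv snd_conv mem_Collect_eq doubleton_eq_iff
      by (metis Un_commute)
  qed
  then show ?thesis
    using incomparable_imp_neq annihilator_Un_neq_iff[of f g] unfolding mem_vertices_iff by blast
qed

lemma adjacentI:
  assumes "f \<in> vertices (AG R)" "g \<in> vertices (AG R)"
    and "x \<in> coz X f" "x \<notin> X closure_of coz X g" "y \<in> coz X g" "y \<notin> X closure_of coz X f"
  shows "adjacent (AG R) f g"
  using assms by (auto simp only: adjacent_iff)

section \<open>Four points: a vertex without a complement\<close>

text \<open>
  Any neighbour \<open>g\<close> of \<open>f\<close> has a common neighbour \<open>h\<close> with \<open>f\<close>. It suffices that \<open>h\<close> is nonzero at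
  one point \<open>q\<close> of \<open>coz f\<close> off the closure of \<open>coz g\<close>, and at one point \<open>p'\<close> off the closure of
  \<open>coz f\<close>, while its support leaves out a point of each cozero set; two points on either side
  of \<open>f\<close> make these four demands compatible.
\<close>

lemma no_complement:
  assumes f: "f \<in> carrier R"
    and ab: "a \<in> coz X f" "b \<in> coz X f" "a \<noteq> b"
    and cd: "c \<in> Y - X closure_of coz X f" "d \<in> Y - X closure_of coz X f" "c \<noteq> d"
  shows "\<not> orthogonal_vertices (AG R) f g"
proof
  assume orth: "orthogonal_vertices (AG R) f g"
  then have adj: "adjacent (AG R) f g" and fV: "f \<in> vertices (AG R)" and gV: "g \<in> vertices (AG R)"
    by (auto simp: orthogonal_vertices_def)
  have g: "g \<in> carrier R" using gV by (simp add: mem_vertices_iff)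
  obtain q p where q: "q \<in> coz X f" "q \<notin> X closure_of coz X g"
      and p: "p \<in> coz X g" "p \<notin> X closure_of coz X f"
    using adj unfolding adjacent_iff by blast
  obtain q' where q': "q' \<in> coz X f" "q' \<noteq> q" using ab by metis
  obtain p' where p': "p' \<in> Y" "p' \<notin> X closure_of coz X f" "p' \<noteq> p" using cd by (metis Diff_iff)
  have inY: "q \<in> Y" "q' \<in> Y" "p \<in> Y" using q q' p coz_subset_P_points f g by blast+
  have "closedin X {q', p}" using inY Y_subset by (intro closed_finite) auto
  then have "openin X (topspace X - {q', p})" by (simp add: openin_diff)
  moreover have "{q, p'} \<subseteq> topspace X - {q', p}"
    using inY p' q' q p Y_subset coz_subset_closure[of X f] by auto
  ultimately obtain h where h: "h \<in> carrier R" "{q, p'} \<subseteq> coz X h"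
      "X closure_of coz X h \<subseteq> topspace X - {q', p}"
    using bump_at_finite_set[of "{q, p'}"] inY p' by blast
  have hV: "h \<in> vertices (AG R)"
    using h inY by (intro mem_verticesI[of h p]) auto
  have hf: "adjacent (AG R) f h"
    using h p' q' by (intro adjacentI[OF fV hV, of q' p']) auto
  have hg: "adjacent (AG R) g h"
    using h q p by (intro adjacentI[OF gV hV, of p q]) auto
  have "h \<noteq> f" "h \<noteq> g" using hf hg coz_subset_closure unfolding adjacent_iff by metis+
  then show False using orth hV hf hg unfolding orthogonal_vertices_def by blast
qed

lemma not_complemented:
  assumes F: "F \<subseteq> Y" "card F = 4"
  shows "\<not> complemented_graph (AG R)"
proof -
  obtain a b c d where abcd: "F = {a, b, c, d}" "a \<noteq> b" "c \<noteq> d" "a \<noteq> c" "a \<noteq> d" "b \<noteq> c" "b \<noteq> d"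
    using F(2) by (auto simp: numeral_eq_Suc card_Suc_eq)
  have inY: "a \<in> Y" "b \<in> Y" "c \<in> Y" "d \<in> Y" using F(1) abcd(1) by auto
  have "closedin X {c, d}" using inY Y_subset by (intro closed_finite) auto
  then have "openin X (topspace X - {c, d})" by (simp add: openin_diff)
  moreover have "{a, b} \<subseteq> topspace X - {c, d}" using inY Y_subset abcd by auto
  ultimately obtain f where f: "f \<in> carrier R" "{a, b} \<subseteq> coz X f"
      "X closure_of coz X f \<subseteq> topspace X - {c, d}"
    using bump_at_finite_set[of "{a, b}"] inY by blast
  have "f \<in> vertices (AG R)" using f inY by (intro mem_verticesI[of f c]) auto
  moreover have "\<not> orthogonal_vertices (AG R) f g" for g
    using f inY abcd by (intro no_complement[of f a b c d]) auto
  ultimately show ?thesis unfolding complemented_graph_def by blast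
qed

section \<open>Finite \<open>X\<^sub>\<P>\<close>: complementary sets\<close>

lemma openin_Y: "openin X Y"
proof (subst openin_subopen, intro ballI)
  fix x assume "x \<in> Y"
  then obtain V where "openin X V" "x \<in> V" "X closure_of V \<in> \<P>" by (auto simp: P_points_def)
  moreover from this have "V \<subseteq> Y" using openin_subset[of X V] by (auto simp: P_points_def)
  ultimately show "\<exists>T. openin X T \<and> x \<in> T \<and> T \<subseteq> Y" by blast
qed

lemma closure_of_coz_eq:
  assumes "finite Y" "f \<in> carrier R"
  shows "X closure_of coz X f = coz X f"
proof -
  have "finite (coz X f)" using coz_subset_P_points[OF assms(2)] assms(1) by (rule finite_subset)
  then have "closedin X (coz X f)" by (rule closed_finite) auto
  then show ?thesis by (rule closure_of_closedin)
qed

text \<open>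
  A subset of a finite \<open>X\<^sub>\<P>\<close> is open, being \<open>X\<^sub>\<P>\<close> minus a finite set, so a function that is nonzero
  on \<open>A\<close> can be chosen with support inside \<open>A\<close>.
\<close>

lemma obtain_coz_eq:
  assumes "finite Y" "A \<subseteq> Y"
  obtains f where "f \<in> carrier R" "coz X f = A"
proof -
  have "closedin X (Y - A)" using assms Y_subset by (intro closed_finite) auto
  then have "openin X (Y - (Y - A))" using openin_Y by (rule openin_diff[rotated])
  then have "openin X A" using assms(2) by (simp add: double_diff)
  then obtain f where f: "f \<in> carrier R" "A \<subseteq> coz X f" "X closure_of coz X f \<subseteq> A"
    using bump_at_finite_set[of A A] assms finite_subset by blast
  then show thesis using that closure_of_coz_eq[OF assms(1) f(1)] by blast
qed

lemma mem_vertices_iff_finite: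
  assumes "finite Y"
  shows "f \<in> vertices (AG R) \<longleftrightarrow> f \<in> carrier R \<and> coz X f \<noteq> {} \<and> coz X f \<noteq> Y"
proof
  assume "f \<in> vertices (AG R)"
  then show "f \<in> carrier R \<and> coz X f \<noteq> {} \<and> coz X f \<noteq> Y"
    unfolding mem_vertices_iff using coz_subset_P_points by blast
next
  assume f: "f \<in> carrier R \<and> coz X f \<noteq> {} \<and> coz X f \<noteq> Y"
  then obtain x where "x \<in> Y" "x \<notin> coz X f" using coz_subset_P_points by blast
  then show "f \<in> vertices (AG R)"
    using f closure_of_coz_eq[OF assms] by (intro mem_verticesI[of f x]) auto
qed

lemma adjacent_iff_finite:
  assumes "finite Y"
  shows "adjacent (AG R) f g \<longleftrightarrow> f \<in> vertices (AG R) \<and> g \<in> vertices (AG R) \<and>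
     \<not> coz X f \<subseteq> coz X g \<and> \<not> coz X g \<subseteq> coz X f"
  using closure_of_coz_eq[OF assms] unfolding adjacent_iff mem_vertices_iff by metis

text \<open>
  If incomparable sets \<open>A\<close> and \<open>B\<close> meet, then the complement of \<open>A \<inter> B\<close> is incomparable with both;
  if they are disjoint without covering \<open>X\<^sub>\<P>\<close>, then the complement of \<open>A \<union> B\<close> is.
\<close>

lemma orthogonal_imp_cozero_complement:
  assumes fin: "finite Y" and orth: "orthogonal_vertices (AG R) f g"
  shows "coz X g = Y - coz X f"
proof (rule ccontr)
  assume neq: "coz X g \<noteq> Y - coz X f"
  have V: "f \<in> vertices (AG R)" "g \<in> vertices (AG R)"
    and inc: "\<not> coz X f \<subseteq> coz X g" "\<not> coz X g \<subseteq> coz X f"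
    using orth unfolding orthogonal_vertices_def adjacent_iff_finite[OF fin] by auto
  have sub: "coz X f \<subseteq> Y" "coz X g \<subseteq> Y"
    using V coz_subset_P_points unfolding mem_vertices_iff by auto
  have "\<exists>C \<subseteq> Y. \<not> coz X f \<subseteq> C \<and> \<not> C \<subseteq> coz X f \<and> \<not> coz X g \<subseteq> C \<and> \<not> C \<subseteq> coz X g"
  proof (cases "coz X f \<inter> coz X g = {}")
    case True
    then show ?thesis
      using inc sub neq by (intro exI[of _ "Y - (coz X f \<union> coz X g)"]) blast
  next
    case False
    then show ?thesis
      using inc sub by (intro exI[of _ "Y - (coz X f \<inter> coz X g)"]) blast
  qed
  then obtain C where C: "C \<subseteq> Y" "\<not> coz X f \<subseteq> C" "\<not> C \<subseteq> coz X f" "\<not> coz X g \<subseteq> C" "\<not> C \<subseteq> coz X g"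
    by blast
  obtain h where h: "h \<in> carrier R" "coz X h = C" using obtain_coz_eq[OF fin C(1)] .
  have "C \<noteq> {}" "C \<noteq> Y" using C sub by blast+
  then have hV: "h \<in> vertices (AG R)" using h by (simp add: mem_vertices_iff_finite[OF fin])
  moreover have "adjacent (AG R) f h" "adjacent (AG R) g h"
    using V hV C h(2) by (auto simp only: adjacent_iff_finite[OF fin])
  moreover have "h \<noteq> f" "h \<noteq> g" using C h(2) by auto
  ultimately show False using orth unfolding orthogonal_vertices_def by blast
qed

lemma complemented_if_card_3:
  assumes card: "card Y = 3"
  shows "complemented_graph (AG R)"
  unfolding complemented_graph_def
proof
  have fin: "finite Y" using card by (simp add: card_ge_0_finite)
  fix f assume fV: "f \<in> vertices (AG R)"
  then have f: "coz X f \<noteq> {}" "coz X f \<subseteq> Y" "coz X f \<noteq> Y"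
    using coz_subset_P_points mem_vertices_iff_finite[OF fin] by auto
  obtain g where g: "g \<in> carrier R" "coz X g = Y - coz X f"
    using obtain_coz_eq[OF fin, of "Y - coz X f"] by blast
  have gV: "g \<in> vertices (AG R)" using f g(1) unfolding mem_vertices_iff_finite[OF fin] g(2) by blast
  have adj: "adjacent (AG R) f g"
    using fV gV f unfolding adjacent_iff_finite[OF fin] g(2) by blast
  have "card (coz X f) + card (coz X g) = 3"
    using card_Diff_subset[OF finite_subset[OF f(2) fin] f(2)] card_mono[OF fin f(2)] card g(2)
    by simp
  moreover have "card (coz X f) \<noteq> 0" "card (coz X g) \<noteq> 0"
    using f(1) mem_vertices_iff_finite[OF fin, of g] gV finite_subset[OF f(2) fin] fin
    by (simp_all add: g(2))
  ultimately have "card (coz X f) = 1 \<or> card (coz X g) = 1" by linarith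
  then obtain x where x: "coz X f = {x} \<or> coz X g = {x}"
    unfolding One_nat_def card_1_singleton_iff by blast
  have "\<not> (adjacent (AG R) f h \<and> adjacent (AG R) g h)" for h
  proof
    assume h: "adjacent (AG R) f h \<and> adjacent (AG R) g h"
    then have inc: "\<not> coz X f \<subseteq> coz X h" "\<not> coz X h \<subseteq> coz X f"
        "\<not> coz X g \<subseteq> coz X h" "\<not> coz X h \<subseteq> coz X g" and "h \<in> carrier R"
      unfolding adjacent_iff_finite[OF fin] mem_vertices_iff by blast+
    have hY: "coz X h \<subseteq> Y" using \<open>h \<in> carrier R\<close> by (rule coz_subset_P_points)
    from x show False
    proof
      assume fx: "coz X f = {x}"
      have "x \<notin> coz X h" using inc(1) unfolding fx by blast
      then have "coz X h \<subseteq> coz X g" using hY unfolding g(2) fx by blast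
      then show False using inc(4) by blast
    next
      assume gx: "coz X g = {x}"
      have "x \<notin> coz X h" using inc(3) unfolding gx by blast
      then have "coz X h \<inter> coz X g = {}" unfolding gx by blast
      then have "coz X h \<subseteq> coz X f" using hY unfolding g(2) by blast
      then show False using inc(2) by blast
    qed
  qed
  then show "\<exists>g \<in> vertices (AG R). orthogonal_vertices (AG R) f g"
    using fV gV adj unfolding orthogonal_vertices_def by blast
qed

lemma uniquely_complemented_if_card_3:
  assumes card: "card Y = 3"
  shows "uniquely_complemented_graph (AG R)"
proof -
  have fin: "finite Y" using card by (simp add: card_ge_0_finite)
  have "{v \<in> vertices (AG R). adjacent (AG R) g v} = {v \<in> vertices (AG R). adjacent (AG R) h v}"
    if "g \<in> vertices (AG R)" "h \<in> vertices (AG R)"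
      "orthogonal_vertices (AG R) f g" "orthogonal_vertices (AG R) f h" for f g h
  proof -
    have "coz X g = coz X h"
      using that(3,4)[THEN orthogonal_imp_cozero_complement[OF fin]] by (rule trans[OF _ sym])
    then show ?thesis using that(1,2) by (simp add: adjacent_iff_finite[OF fin])
  qed
  then show ?thesis
    using complemented_if_card_3[OF card] unfolding uniquely_complemented_graph_def by blast
qed

end

section \<open>The characterization\<close>

theorem theorem3p22:
  fixes X :: "'a topology" and \<P> :: "'a set set"
  assumes "Tychonoff_space X"
    and "ideal_of_closed_sets X \<P>"
    and "infinite (P_points X \<P>) \<or> card (P_points X \<P>) \<ge> 3"
  shows "uniquely_complemented_graph (AG (CP_ring X \<P>)) \<longleftrightarrow> card (P_points X \<P>) = 3"
proof -
  interpret Tychonoff_closed_ideal X \<P> using assms(1,2) by unfold_locales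
  show ?thesis
  proof
    assume "uniquely_complemented_graph (AG R)"
    then have comp: "complemented_graph (AG R)" by (simp add: uniquely_complemented_graph_def)
    show "card Y = 3"
    proof (rule ccontr)
      assume "card Y \<noteq> 3"
      then have "infinite Y \<or> 4 \<le> card Y" using assms(3) by auto
      then obtain F where "F \<subseteq> Y" "card F = 4"
        by (metis infinite_arbitrarily_large obtain_subset_with_card_n)
      then show False using not_complemented comp by blast
    qed
  qed (rule uniquely_complemented_if_card_3)
qed

end
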